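(* Let $n\ge 1$. For every permutation $\pi\in S_n$ with inversion graph $G_\pi$, \[ c(\pi) - \kappa(\pi) \le \beta(G_\pi). \]
   Context: $c(\pi)$ is the number of cycles of $\pi$, including fixed points. Inversion graph: $G_\pi$ is the simple graph with vertex set $[n]=\{1,\dots,n\}$ (the values of $\pi$) in which values $a<b$ are adjacent if and only if $b$ appears to the left of $a$ in the one-line notation $\pi(1)\cdots\pi(n)$, i.e. $\pi^{-1}(b)<\pi^{-1}(a)$. Cyclomatic number: $\beta(G) = |E(G)| - |V(G)| + \kappa(G)$, where $\kappa(G)$ is the number of connected components of the graph $G$. Sum components: for $\pi_1\in S_m$, $\pi_2\in S_k$, the direct sum $\pi_1\oplus\pi_2\in S_{m+k}$ has one-line notation that of $\pi_1$ followed by that of $\pi_2$ with every entry increased by $m$. A permutation is sum indecomposable if it is not the direct sum of two nonempty permutations. Every permutation is uniquely $\alpha_1\oplus\cdots\oplus\alpha_k$ with each $\alpha_i$ nonempty and sum indecomposable; the $\alpha_i$ are the sum components of $\pi$, and $\kappa(\pi)$ denotes their number. (It is a known fact that $\kappa(\pi)=\kappa(G_\pi)$.) *)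

theory Defs
  imports "HOL-Combinatorics.Orbits"
begin

text \<open>The orbit of a fixed point is a singleton, so fixed points are counted.\<close>

definition cycle_count :: "nat \<Rightarrow> (nat \<Rightarrow> nat) \<Rightarrow> nat" where
  "cycle_count n \<pi> = card (orbit \<pi> ` {1..n})"

text \<open>A graph is a pair of a vertex set and a set of edges, an edge being a two-element set of
  vertices.\<close>

type_synonym 'a ugraph = "'a set \<times> 'a set set"

abbreviation verts :: "'a ugraph \<Rightarrow> 'a set" where "verts G \<equiv> fst G"
abbreviation edges :: "'a ugraph \<Rightarrow> 'a set set" where "edges G \<equiv> snd G"

definition simple_graph :: "'a ugraph \<Rightarrow> bool" where
  "simple_graph G \<longleftrightarrow> finite (verts G) \<and> (\<forall>e\<in>edges G. e \<subseteq> verts G \<and> card e = 2)"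

definition connected_rel :: "'a ugraph \<Rightarrow> ('a \<times> 'a) set" where
  "connected_rel G = {(u, v). u \<in> verts G \<and> v \<in> verts G \<and> (u, v) \<in> {(a, b). {a, b} \<in> edges G}\<^sup>*}"

definition connected_components :: "'a ugraph \<Rightarrow> 'a set set" where
  "connected_components G = verts G // connected_rel G"

definition cyclomatic_number :: "'a ugraph \<Rightarrow> int" where
  "cyclomatic_number G =
     int (card (edges G)) - int (card (verts G)) + int (card (connected_components G))"

definition inversion_graph :: "nat \<Rightarrow> (nat \<Rightarrow> nat) \<Rightarrow> nat ugraph" where
  "inversion_graph n \<pi> =
     ({1..n}, {{a, b} | a b. a \<in> {1..n} \<and> b \<in> {1..n} \<and> a < b \<and> inv \<pi> b < inv \<pi> a})"

lemma simple_graph_inversion_graph: "simple_graph (inversion_graph n \<pi>)"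
  by (auto simp: simple_graph_def inversion_graph_def)

definition perm_word :: "nat list \<Rightarrow> bool" where
  "perm_word w \<longleftrightarrow> distinct w \<and> set w = {1..length w}"

definition one_line :: "nat \<Rightarrow> (nat \<Rightarrow> nat) \<Rightarrow> nat list" where
  "one_line n \<pi> = map \<pi> [1..<Suc n]"

definition direct_sum :: "nat list \<Rightarrow> nat list \<Rightarrow> nat list" (infixr \<open>\<oplus>\<^sub>w\<close> 65) where
  "u \<oplus>\<^sub>w v = u @ map (\<lambda>i. i + length u) v"

definition sum_indecomposable :: "nat list \<Rightarrow> bool" where
  "sum_indecomposable w \<longleftrightarrow>
     \<not> (\<exists>u v. perm_word u \<and> perm_word v \<and> u \<noteq> [] \<and> v \<noteq> [] \<and> w = u \<oplus>\<^sub>w v)"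

definition is_sum_decomposition :: "nat list list \<Rightarrow> nat list \<Rightarrow> bool" where
  "is_sum_decomposition \<alpha>s w \<longleftrightarrow>
     (\<forall>\<alpha>\<in>set \<alpha>s. perm_word \<alpha> \<and> \<alpha> \<noteq> [] \<and> sum_indecomposable \<alpha>) \<and> w = foldr (\<oplus>\<^sub>w) \<alpha>s []"

text \<open>The description is proper: see \<open>ex1_sum_decomposition\<close> below.\<close>

definition sum_components :: "nat list \<Rightarrow> nat list list" where
  "sum_components w = (THE \<alpha>s. is_sum_decomposition \<alpha>s w)"

definition sum_component_count :: "nat \<Rightarrow> (nat \<Rightarrow> nat) \<Rightarrow> nat" where
  "sum_component_count n \<pi> = length (sum_components (one_line n \<pi>))"

lemma perm_word_one_line:
  assumes "\<pi> permutes {1..n}"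
  shows "perm_word (one_line n \<pi>)"
proof -
  have "{Suc 0..<Suc n} = {1..n}" by auto
  then show ?thesis
    using permutes_image[OF assms] permutes_inj_on[OF assms]
    by (simp add: perm_word_def one_line_def distinct_map del: upt_Suc)
qed

lemma map_add_eq_iff: "map (\<lambda>i. i + k) x = map (\<lambda>i. i + k) y \<longleftrightarrow> x = y" for k :: nat
  by (simp add: inj_map_eq_map inj_def)

lemma perm_word_suffix:
  assumes "perm_word u" "perm_word (u @ z)"
  shows "\<exists>v. perm_word v \<and> u @ z = u \<oplus>\<^sub>w v"
proof -
  define k where "k = length u"
  have du: "distinct z" "set u \<inter> set z = {}" "set u \<union> set z = {1..k + length z}" "set u = {1..k}"
    using assms by (auto simp: perm_word_def k_def)
  then have "set z = {1..k + length z} - {1..k}" by blast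
  also have "\<dots> = {k+1..k + length z}" by auto
  finally have sz: "set z = {k+1..k + length z}" .
  define v where "v = map (\<lambda>i. i - k) z"
  have "map (\<lambda>i. i + k) v = z"
    unfolding v_def map_map by (rule map_idI) (use sz in auto)
  moreover have "distinct v"
    using du(1) sz by (auto simp: v_def distinct_map inj_on_def)
  moreover have "set v = {1..length v}"
  proof -
    have "(\<lambda>i. i - k) ` {k+1..k + length z} = {1..length z}"
    proof (intro equalityI subsetI)
      fix x assume "x \<in> {1..length z}"
      then show "x \<in> (\<lambda>i. i - k) ` {k+1..k + length z}"
        by (intro image_eqI[of _ _ "x + k"]) auto
    qed auto
    then show ?thesis by (simp add: v_def sz)
  qed
  ultimately have "perm_word v \<and> u @ z = u \<oplus>\<^sub>w v"
    by (simp add: perm_word_def direct_sum_def k_def)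
  then show ?thesis ..
qed

lemma sum_decomposition_unique:
  assumes "is_sum_decomposition \<alpha>s w" "is_sum_decomposition \<beta>s w"
  shows "\<alpha>s = \<beta>s"
  using assms
proof (induction \<alpha>s arbitrary: \<beta>s w)
  case Nil
  then show ?case
    by (cases \<beta>s) (auto simp: is_sum_decomposition_def direct_sum_def)
next
  case (Cons a \<alpha>s)
  then obtain b \<beta>s' where \<beta>s: "\<beta>s = b # \<beta>s'"
    by (cases \<beta>s) (auto simp: is_sum_decomposition_def direct_sum_def)
  define x where "x = foldr (\<oplus>\<^sub>w) \<alpha>s []"
  define y where "y = foldr (\<oplus>\<^sub>w) \<beta>s' []"
  have eq: "a \<oplus>\<^sub>w x = b \<oplus>\<^sub>w y"
    using Cons.prems by (simp add: \<beta>s is_sum_decomposition_def x_def y_def)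
  have a: "perm_word a" "a \<noteq> []" "sum_indecomposable a"
    and b: "perm_word b" "b \<noteq> []" "sum_indecomposable b"
    using Cons.prems by (auto simp: \<beta>s is_sum_decomposition_def)
  have key: "u = v" if uv: "perm_word u" "u \<noteq> []" "perm_word v" "sum_indecomposable v" "v = u @ z"
    for u v z
  proof (rule ccontr)
    assume "u \<noteq> v"
    with uv(5) have "z \<noteq> []" by auto
    obtain v' where v': "perm_word v'" "v = u \<oplus>\<^sub>w v'"
      using perm_word_suffix[of u z] uv(1,3) unfolding uv(5) by blast
    with \<open>z \<noteq> []\<close> uv(5) have "v' \<noteq> []" by (auto simp: direct_sum_def)
    with v' uv(1,2,4) show False
      unfolding sum_indecomposable_def by blast
  qed
  from eq obtain z where "a = b @ z \<or> b = a @ z"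
    unfolding direct_sum_def append_eq_append_conv2 by blast
  then have ab: "a = b"
  proof
    assume "a = b @ z" with key[of b a z] a b show ?thesis by blast
  next
    assume "b = a @ z" with key[of a b z] a b show ?thesis by blast
  qed
  then have "x = y" using eq by (simp add: direct_sum_def map_add_eq_iff)
  moreover have "is_sum_decomposition \<alpha>s x" "is_sum_decomposition \<beta>s' y"
    using Cons.prems by (auto simp: \<beta>s is_sum_decomposition_def x_def y_def)
  ultimately have "\<alpha>s = \<beta>s'" using Cons.IH by blast
  with ab \<beta>s show ?case by simp
qed

lemma direct_sum_assoc: "(u \<oplus>\<^sub>w v) \<oplus>\<^sub>w w = u \<oplus>\<^sub>w (v \<oplus>\<^sub>w w)"
  by (simp add: direct_sum_def comp_def add.assoc add.commute)

lemma foldr_direct_sum_append: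
  "foldr (\<oplus>\<^sub>w) (\<alpha>s @ \<beta>s) [] = foldr (\<oplus>\<^sub>w) \<alpha>s [] \<oplus>\<^sub>w foldr (\<oplus>\<^sub>w) \<beta>s []"
proof (induction \<alpha>s)
  case Nil
  show ?case by (simp add: direct_sum_def)
next
  case (Cons a \<alpha>s)
  then show ?case by (simp add: direct_sum_assoc)
qed

lemma sum_decomposition_exists:
  assumes "perm_word w"
  shows "\<exists>\<alpha>s. is_sum_decomposition \<alpha>s w"
  using assms
proof (induction w rule: length_induct)
  case (1 w)
  consider "w = []" | "w \<noteq> []" "sum_indecomposable w"
    | u v where "perm_word u" "perm_word v" "u \<noteq> []" "v \<noteq> []" "w = u \<oplus>\<^sub>w v"
    unfolding sum_indecomposable_def by blast
  then show ?case
  proof cases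
    case 1
    then have "is_sum_decomposition [] w" by (simp add: is_sum_decomposition_def)
    then show ?thesis ..
  next
    case 2
    then have "is_sum_decomposition [w] w"
      using "1.prems" by (simp add: is_sum_decomposition_def direct_sum_def)
    then show ?thesis ..
  next
    case 3
    then have "length u < length w" "length v < length w" by (auto simp: direct_sum_def)
    then obtain \<alpha>s \<beta>s where "is_sum_decomposition \<alpha>s u" "is_sum_decomposition \<beta>s v"
      using "1.IH" 3 by blast
    then have "is_sum_decomposition (\<alpha>s @ \<beta>s) w"
      using 3(5) foldr_direct_sum_append[of \<alpha>s \<beta>s] by (auto simp: is_sum_decomposition_def simp del: foldr_append)
    then show ?thesis ..
  qed
qed

lemma ex1_sum_decomposition:
  "perm_word w \<Longrightarrow> \<exists>!\<alpha>s. is_sum_decomposition \<alpha>s w"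
  using sum_decomposition_exists sum_decomposition_unique by blast

end

theory Submission
  imports Defs
begin

text \<open>Call \<open>i\<close> with \<open>0 \<le> i < n\<close> a cut of \<open>\<pi>\<close> if \<open>\<pi>\<close> maps \<open>{1..i}\<close> onto itself. Cuts are the places where
  \<open>\<pi>\<close> splits as a direct sum, so there are as many of them as sum components of \<open>\<pi>\<close> and as connected
  components of its inversion graph. Since the edges of that graph are the inversions, the claim
  becomes
  \<open>c(\<pi>) + n \<le> inv(\<pi>) + 2 * |cuts(\<pi>)|\<close>,
  and the original inequality follows from it by bounding one copy of \<open>|cuts(\<pi>)|\<close> by the number of sum
  components and the other by the number of connected components.

  The inequality \<open>cycles_le_inversions_cuts\<close> is a Riemann-Hurwitz count for sorting by adjacent
  transpositions, by induction on the number of inversions. The identity has equality. Otherwise \<open>\<pi>\<close>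
  has a descent \<open>i\<close>; swapping its entries at \<open>i\<close> and \<open>i + 1\<close> gives \<open>\<rho>\<close> with one inversion fewer, and the
  cuts of \<open>\<pi>\<close> are those of \<open>\<rho>\<close> except \<open>i\<close>. Now compare \<open>\<pi>\<close> with \<open>\<rho>\<close>. If \<open>i\<close> is not a cut of \<open>\<rho>\<close>, the
  right side grows by one and the transposition creates at most one new cycle. If \<open>i\<close> is a cut of \<open>\<rho>\<close>,
  the right side drops by one; but then \<open>i\<close> and \<open>i + 1\<close> lie in different cycles of \<open>\<rho>\<close>, and the
  transposition merges these, so the left side drops by one as well. The two estimates on cycles are
  \<open>card_orbits_comp_transpose\<close>.\<close>

section \<open>Multiplying a permutation by a transposition\<close>

lemma self_in_orbit:
  assumes "f permutes S" "finite S"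
  shows "x \<in> orbit f x"
proof -
  have "permutation f" using assms permutation_permutes by blast
  then show ?thesis by (rule permutation_self_in_orbit)
qed

lemma orbit_eq_iff_mem:
  assumes "f permutes S" "finite S"
  shows "orbit f x = orbit f y \<longleftrightarrow> x \<in> orbit f y"
  using orbit_cyclic_eq3[OF cyclic_on_orbit[OF assms]] self_in_orbit[OF assms] by metis

text \<open>A cycle of \<open>g\<close> through neither \<open>a\<close> nor \<open>b\<close> never notices the transposition, so it is also a cycle of
  \<open>f\<close>. This one inclusion serves for both estimates on the number of cycles below: only the sizes of
  the two doubletons differ.\<close>

lemma orbits_comp_transpose_subset:
  assumes f: "f permutes S" and fin: "finite S" and ab: "a \<in> S" "b \<in> S"
  defines "g \<equiv> f \<circ> transpose a b"
  shows "orbit g ` S \<subseteq> (orbit f ` S - {orbit f a, orbit f b}) \<union> {orbit g a, orbit g b}"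
proof
  fix C assume "C \<in> orbit g ` S"
  then obtain x where x: "x \<in> S" "C = orbit g x" by blast
  have g: "g permutes S"
    unfolding g_def using f ab by (intro permutes_compose permutes_swap_id)
  show "C \<in> (orbit f ` S - {orbit f a, orbit f b}) \<union> {orbit g a, orbit g b}"
  proof (cases "a \<in> C \<or> b \<in> C")
    case True
    then have "orbit g a = C \<or> orbit g b = C"
      using orbit_eq_iff_mem[OF g fin] unfolding x(2) by metis
    then show ?thesis by auto
  next
    case False
    have "orbit f x = orbit g x"
    proof (rule orbit_cong)
      show "x \<in> orbit g x" by (rule self_in_orbit[OF g fin])
      fix s assume "s \<in> orbit g x"
      then have "s \<noteq> a" "s \<noteq> b" using False x by auto
      then show "f s = g s" by (simp add: g_def transpose_def)
    qed
    then have "C \<in> orbit f ` S" using x by blast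
    moreover have "C \<noteq> orbit f a" "C \<noteq> orbit f b"
      using False self_in_orbit[OF f fin] by blast+
    ultimately show ?thesis by blast
  qed
qed

text \<open>Following \<open>g\<close> from \<open>a\<close> leads to \<open>f b\<close> and then along the \<open>f\<close>-cycle of \<open>b\<close>, which avoids \<open>a\<close>, up to
  \<open>b\<close> itself. The formal argument is the contrapositive: if the \<open>g\<close>-cycle of \<open>a\<close> missed \<open>b\<close>, it would
  contain the whole \<open>f\<close>-cycle of \<open>b\<close>.\<close>

lemma orbit_comp_transpose_merge:
  assumes f: "f permutes S" and fin: "finite S" and ab: "a \<in> S" "b \<in> S"
    and disj: "a \<notin> orbit f b"
  defines "g \<equiv> f \<circ> transpose a b"
  shows "orbit g a = orbit g b"
proof (rule ccontr)
  assume neq: "orbit g a \<noteq> orbit g b"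
  have g: "g permutes S"
    unfolding g_def using f ab by (intro permutes_compose permutes_swap_id)
  have b: "b \<notin> orbit g a" using neq orbit_eq_iff_mem[OF g fin] by metis
  have "y \<in> orbit g a \<inter> orbit f b" if "y \<in> orbit f b" for y
    using that
  proof induction
    case base
    have "g a = f b" by (simp add: g_def)
    then show ?case using orbit.base[of g a] orbit.base[of f b] by simp
  next
    case (step y)
    then have "y \<noteq> a" "y \<noteq> b" using b disj by auto
    then have "f y = g y" by (simp add: g_def transpose_def)
    then show ?case using step.IH orbit.step[of y g a] orbit.step[of y f b] by simp
  qed
  then show False using b self_in_orbit[OF f fin] by blast
qed

lemma card_orbits_comp_transpose:
  assumes f: "f permutes S" and fin: "finite S" and ab: "a \<in> S" "b \<in> S"
  shows "card (orbit (f \<circ> transpose a b) ` S) \<le> Suc (card (orbit f ` S))"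
    and "a \<notin> orbit f b \<Longrightarrow> Suc (card (orbit (f \<circ> transpose a b) ` S)) \<le> card (orbit f ` S)"
proof -
  define g where "g = f \<circ> transpose a b"
  define R where "R = orbit f ` S - {orbit f a, orbit f b}"
  have finR: "finite R" using fin by (simp add: R_def)
  have "card (orbit g ` S) \<le> card (R \<union> {orbit g a, orbit g b})"
    using orbits_comp_transpose_subset[OF f fin ab] finR
    by (intro card_mono) (auto simp: g_def R_def)
  also have "\<dots> \<le> card R + card {orbit g a, orbit g b}" by (rule card_Un_le)
  finally have le: "card (orbit g ` S) \<le> card R + card {orbit g a, orbit g b}" .
  have R: "card R + card {orbit f a, orbit f b} = card (orbit f ` S)"
    unfolding R_def using fin ab
    by (subst card_Diff_subset) (auto intro!: le_add_diff_inverse2 card_mono)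
  have "card {orbit f a, orbit f b} \<ge> 1" "card {orbit g a, orbit g b} \<le> 2"
    by (auto simp: card_insert_if)
  then show "card (orbit (f \<circ> transpose a b) ` S) \<le> Suc (card (orbit f ` S))"
    using le R by (simp add: g_def)
  assume disj: "a \<notin> orbit f b"
  then have "orbit f a \<noteq> orbit f b"
    using orbit_eq_iff_mem[OF f fin] by metis
  then have "card {orbit f a, orbit f b} = 2" by simp
  moreover have "card {orbit g a, orbit g b} = 1"
    using orbit_comp_transpose_merge[OF f fin ab disj] by (simp add: g_def)
  ultimately show "Suc (card (orbit (f \<circ> transpose a b) ` S)) \<le> card (orbit f ` S)"
    using le R by (simp add: g_def)
qed

section \<open>Cycles, inversions and cuts\<close>

definition inversions :: "nat \<Rightarrow> (nat \<Rightarrow> nat) \<Rightarrow> (nat \<times> nat) set" where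
  "inversions n \<pi> = {(a, b). a \<in> {1..n} \<and> b \<in> {1..n} \<and> a < b \<and> \<pi> b < \<pi> a}"

text \<open>The trivial cut \<open>0\<close> is included, while \<open>n\<close> is not, so that the number of cuts is the number of sum
  components, also when \<open>n = 0\<close>.\<close>

definition cuts :: "nat \<Rightarrow> (nat \<Rightarrow> nat) \<Rightarrow> nat set" where
  "cuts n \<pi> = {i. i < n \<and> \<pi> ` {1..i} = {1..i}}"

lemma finite_inversions: "finite (inversions n \<pi>)"
  by (rule finite_subset[of _ "{1..n} \<times> {1..n}"]) (auto simp: inversions_def)

lemma finite_cuts: "finite (cuts n \<pi>)"
  by (rule finite_subset[of _ "{..<n}"]) (auto simp: cuts_def)

lemma permutes_no_descent_imp_id:
  fixes \<pi> :: "nat \<Rightarrow> nat"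
  assumes \<pi>: "\<pi> permutes {1..n}" and asc: "\<And>i. 1 \<le> i \<Longrightarrow> i < n \<Longrightarrow> \<pi> i < \<pi> (Suc i)"
  shows "\<pi> = id"
proof (rule permutes_natset_ge[OF \<pi>], rule ballI)
  fix i assume "i \<in> {1..n}"
  then have "1 \<le> i" "i \<le> n" by auto
  then show "i \<le> \<pi> i"
  proof (induction i rule: dec_induct)
    case base
    then show ?case using permutes_in_image[OF \<pi>, of 1] by simp
  next
    case (step i)
    then show ?case using asc[of i] by simp
  qed
qed

text \<open>Swapping the two entries of a descent relabels the positions of every other inversion and
  destroys exactly the inversion \<open>(i, Suc i)\<close>.\<close>

lemma card_inversions_descent:
  assumes i: "1 \<le> i" "i < n" and desc: "\<pi> (Suc i) < \<pi> i"
  shows "card (inversions n \<pi>) = Suc (card (inversions n (\<pi> \<circ> transpose i (Suc i))))"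
proof -
  define t where "t = transpose i (Suc i)"
  have tt: "t (t x) = x" for x by (simp add: t_def)
  have t_mem: "t x \<in> {1..n} \<longleftrightarrow> x \<in> {1..n}" for x
    using i by (auto simp: t_def transpose_def)
  \<comment> \<open>No number lies strictly between \<open>i\<close> and \<open>Suc i\<close>, so no other pair changes its order.\<close>
  have t_less: "t a < t b" if "a < b" "(a, b) \<noteq> (i, Suc i)" for a b
    using that by (auto simp: t_def transpose_def)
  have fwd: "map_prod t t p \<in> inversions n (\<pi> \<circ> t)" if "p \<in> inversions n \<pi> - {(i, Suc i)}" for p
    using that t_mem t_less by (cases p) (simp add: inversions_def tt)
  have bwd: "map_prod t t p \<in> inversions n \<pi> - {(i, Suc i)}" if "p \<in> inversions n (\<pi> \<circ> t)" for p
  proof -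
    obtain a b where p: "p = (a, b)" by fastforce
    have "(a, b) \<noteq> (i, Suc i)" using that desc by (auto simp: p inversions_def t_def)
    moreover have "(t a, t b) \<noteq> (i, Suc i)" if "a < b"
      using that by (auto simp: t_def transpose_def split: if_splits)
    ultimately show ?thesis using that t_mem t_less by (simp add: p inversions_def)
  qed
  have "bij_betw (map_prod t t) (inversions n \<pi> - {(i, Suc i)}) (inversions n (\<pi> \<circ> t))"
  proof (rule bij_betw_byWitness[where f' = "map_prod t t"])
    show "map_prod t t ` (inversions n \<pi> - {(i, Suc i)}) \<subseteq> inversions n (\<pi> \<circ> t)"
      by (rule image_subsetI) (rule fwd)
    show "map_prod t t ` inversions n (\<pi> \<circ> t) \<subseteq> inversions n \<pi> - {(i, Suc i)}"
      by (rule image_subsetI) (rule bwd)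
  qed (auto simp: tt)
  then have "card (inversions n (\<pi> \<circ> t)) = card (inversions n \<pi> - {(i, Suc i)})"
    by (simp add: bij_betw_same_card)
  moreover have "(i, Suc i) \<in> inversions n \<pi>" using i desc by (simp add: inversions_def)
  ultimately show ?thesis using finite_inversions[of n \<pi>]
    by (metis t_def card_Suc_Diff1)
qed

text \<open>For \<open>j \<noteq> i\<close> the interval \<open>{1..j}\<close> contains both or neither of \<open>i\<close> and \<open>Suc i\<close>, so it does not see the
  transposition. At \<open>i\<close> itself a cut would force \<open>\<pi> i \<le> i < \<pi> (Suc i)\<close>, an ascent.\<close>

lemma cuts_descent:
  assumes \<pi>: "\<pi> permutes {1..n}" and i: "1 \<le> i" and desc: "\<pi> (Suc i) < \<pi> i"
  shows "cuts n \<pi> = cuts n (\<pi> \<circ> transpose i (Suc i)) - {i}"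
proof -
  have "transpose i (Suc i) ` {1..j} = {1..j}" if "j \<noteq> i" for j
    by (subst transpose_image_eq) (use i that in auto)
  then have "(\<pi> \<circ> transpose i (Suc i)) ` {1..j} = \<pi> ` {1..j}" if "j \<noteq> i" for j
    using that by (simp only: image_comp[symmetric] not_False_eq_True)
  then have "j \<in> cuts n \<pi> \<longleftrightarrow> j \<in> cuts n (\<pi> \<circ> transpose i (Suc i))" if "j \<noteq> i" for j
    using that by (simp add: cuts_def)
  moreover have "i \<notin> cuts n \<pi>"
  proof
    assume "i \<in> cuts n \<pi>"
    then have im: "\<pi> ` {1..i} = {1..i}" by (simp add: cuts_def)
    have "\<pi> i \<in> \<pi> ` {1..i}" using i by auto
    then have "\<pi> i \<le> i" using im by simp
    moreover have "\<pi> (Suc i) \<noteq> 0"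
      using permutes_in_image[OF \<pi>, of "Suc i"] permutes_not_in[OF \<pi>, of "Suc i"]
      by (cases "Suc i \<in> {1..n}") auto
    ultimately have "\<pi> (Suc i) \<in> {1..i}" using desc by auto
    then have "Suc i \<in> {1..i}"
      using inj_image_mem_iff[OF permutes_inj[OF \<pi>], of "Suc i" "{1..i}"] im by metis
    then show False by simp
  qed
  ultimately have "j \<in> cuts n \<pi> \<longleftrightarrow> j \<in> cuts n (\<pi> \<circ> transpose i (Suc i)) - {i}" for j
    by (cases "j = i") simp_all
  then show ?thesis by blast
qed

lemma orbit_cut_subset:
  assumes "\<pi> ` {1..i} = {1..i}" "x \<in> {1..i}"
  shows "orbit \<pi> x \<subseteq> {1..i}"
proof
  fix y assume "y \<in> orbit \<pi> x"
  then show "y \<in> {1..i}"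
  proof induction
    case base
    then show ?case using imageI[OF assms(2), of \<pi>] assms(1) by simp
  next
    case (step y)
    then show ?case using imageI[OF step.IH, of \<pi>] assms(1) by simp
  qed
qed

text \<open>Equality holds for the identity, and each adjacent transposition that creates an inversion
  preserves the inequality: losing a cut costs two on the right, and it is paid for by the merging of
  two cycles together with the new inversion.\<close>

theorem cycles_le_inversions_cuts:
  assumes "\<pi> permutes {1..n}"
  shows "cycle_count n \<pi> + n \<le> card (inversions n \<pi>) + 2 * card (cuts n \<pi>)"
  using assms
proof (induction "card (inversions n \<pi>)" arbitrary: \<pi> rule: less_induct)
  case less
  show ?case
  proof (cases "\<exists>i. 1 \<le> i \<and> i < n \<and> \<pi> (Suc i) < \<pi> i")
    case False
    have "\<pi> (Suc i) \<noteq> \<pi> i" for i using permutes_inj[OF less.prems] by (metis injD n_not_Suc_n)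
    then have "\<pi> = id"
      using permutes_no_descent_imp_id[OF less.prems] False by (metis linorder_neqE_nat)
    moreover have "card (orbit id ` {1..n}) \<le> n" using card_image_le[of "{1..n}"] by force
    moreover have "cuts n id = {..<n}" by (auto simp: cuts_def)
    ultimately show ?thesis by (simp add: cycle_count_def)
  next
    case True
    then obtain i where i: "1 \<le> i" "i < n" and desc: "\<pi> (Suc i) < \<pi> i" by blast
    define t where "t = transpose i (Suc i)"
    define \<rho> where "\<rho> = \<pi> \<circ> t"
    have \<rho>: "\<rho> permutes {1..n}"
      unfolding \<rho>_def t_def using i less.prems by (intro permutes_compose permutes_swap_id) auto
    have \<pi>: "\<pi> = \<rho> \<circ> t" by (simp add: \<rho>_def t_def comp_assoc)
    have inv: "card (inversions n \<pi>) = Suc (card (inversions n \<rho>))"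
      unfolding \<rho>_def t_def by (rule card_inversions_descent[OF i desc])
    have cuts: "cuts n \<pi> = cuts n \<rho> - {i}"
      unfolding \<rho>_def t_def by (rule cuts_descent[OF less.prems i(1) desc])
    have IH: "cycle_count n \<rho> + n \<le> card (inversions n \<rho>) + 2 * card (cuts n \<rho>)"
      using less.hyps[OF _ \<rho>] inv by simp
    have ends: "Suc i \<in> {1..n}" "i \<in> {1..n}" using i by auto
    have t': "t = transpose (Suc i) i" by (simp add: t_def transpose_commute)
    \<comment> \<open>Does the transposition join two blocks of \<open>\<rho>\<close> or act within one?\<close>
    show ?thesis
    proof (cases "i \<in> cuts n \<rho>")
      case True
      then have "\<rho> ` {1..i} = {1..i}" by (simp add: cuts_def)
      then have "Suc i \<notin> orbit \<rho> i" using orbit_cut_subset[of \<rho> i i] i by auto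
      then have "Suc (cycle_count n \<pi>) \<le> cycle_count n \<rho>"
        using card_orbits_comp_transpose(2)[OF \<rho> finite_atLeastAtMost ends]
        by (simp add: cycle_count_def \<pi> t')
      moreover have "card (cuts n \<rho>) = Suc (card (cuts n \<pi>))"
        using True cuts finite_cuts[of n \<rho>] by (metis card_Suc_Diff1)
      ultimately show ?thesis using IH inv by simp
    next
      case False
      then have "cuts n \<pi> = cuts n \<rho>" using cuts by simp
      moreover have "cycle_count n \<pi> \<le> Suc (cycle_count n \<rho>)"
        using card_orbits_comp_transpose(1)[OF \<rho> finite_atLeastAtMost ends]
        by (simp add: cycle_count_def \<pi> t')
      ultimately show ?thesis using IH inv by simp
    qed
  qed
qed

section \<open>Cuts, the inversion graph and sum components\<close>

lemma cuts_inv: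
  assumes \<pi>: "\<pi> permutes {1..n}"
  shows "cuts n (inv \<pi>) = cuts n \<pi>"
proof -
  have "inv \<pi> ` A = A \<longleftrightarrow> \<pi> ` A = A" for A
  proof
    show "\<pi> ` A = A" if "inv \<pi> ` A = A"
      using that image_f_inv_f[OF permutes_surj[OF \<pi>], of A] by simp
    show "inv \<pi> ` A = A" if "\<pi> ` A = A"
      using that image_inv_f_f[OF permutes_inj[OF \<pi>], of A] by simp
  qed
  then show ?thesis by (simp add: cuts_def)
qed

lemma cycle_count_inv:
  assumes "\<pi> permutes {1..n}"
  shows "cycle_count n (inv \<pi>) = cycle_count n \<pi>"
proof -
  have "permutation \<pi>" using assms permutation_permutes by blast
  then show ?thesis by (simp add: cycle_count_def orbit_inv_eq)
qed

text \<open>The inversion graph lives on values, hence it records inversions of positions of the inverse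
  permutation. The passage to the inverse is harmless, because it changes neither cycles nor cuts.\<close>

lemma card_edges_inversion_graph:
  "card (edges (inversion_graph n \<pi>)) = card (inversions n (inv \<pi>))"
proof -
  have "edges (inversion_graph n \<pi>) = (\<lambda>(a, b). {a, b}) ` inversions n (inv \<pi>)"
    by (auto simp: inversion_graph_def inversions_def image_def)
  moreover have "inj_on (\<lambda>(a, b). {a, b}) (inversions n (inv \<pi>))"
    by (auto simp: inj_on_def inversions_def doubleton_eq_iff)
  ultimately show ?thesis by (simp add: card_image)
qed

text \<open>No edge crosses a cut: values up to \<open>i\<close> all occur before the values above \<open>i\<close>.\<close>

lemma connected_respects_cut:
  assumes cut: "i \<in> cuts n (inv \<pi>)" and \<pi>: "\<pi> permutes {1..n}"
    and conn: "(u, v) \<in> {(a, b). {a, b} \<in> edges (inversion_graph n \<pi>)}\<^sup>*"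
  shows "u \<le> i \<longleftrightarrow> v \<le> i"
  using conn
proof induction
  case (step v w)
  have im: "inv \<pi> ` {1..i} = {1..i}" using cut by (simp add: cuts_def)
  have inj: "inj (inv \<pi>)" using permutes_inj[OF permutes_inv[OF \<pi>]] .
  have side: "inv \<pi> a \<le> i \<longleftrightarrow> a \<le> i" if "a \<in> {1..n}" for a
  proof -
    have "inv \<pi> a \<in> {1..n}" using permutes_in_image[OF permutes_inv[OF \<pi>]] that by blast
    then show ?thesis using inj_image_mem_iff[OF inj, of a "{1..i}"] im that by auto
  qed
  have "v \<le> i \<longleftrightarrow> w \<le> i"
  proof -
    obtain a b where ab: "{v, w} = {a, b}" "a \<in> {1..n}" "b \<in> {1..n}" "a < b" "inv \<pi> b < inv \<pi> a"
      using step.hyps(2) by (auto simp: inversion_graph_def)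
    then have "a \<le> i \<longleftrightarrow> b \<le> i" using side[of a] side[of b] by linarith
    then show ?thesis using ab(1) by (auto simp: doubleton_eq_iff)
  qed
  then show ?case using step.IH by simp
qed simp

text \<open>The first vertices \<open>Suc i\<close> of the blocks, for \<open>i\<close> a cut, lie in different components: of two such
  vertices, the larger one lies beyond its own cut and the smaller one does not.\<close>

lemma card_cuts_le_connected_components:
  assumes \<pi>: "\<pi> permutes {1..n}"
  shows "card (cuts n \<pi>) \<le> card (connected_components (inversion_graph n \<pi>))"
proof (rule card_inj_on_le)
  let ?r = "connected_rel (inversion_graph n \<pi>)"
  have V: "verts (inversion_graph n \<pi>) = {1..n}" by (simp add: inversion_graph_def)
  show "(\<lambda>i. ?r `` {Suc i}) ` cuts n \<pi> \<subseteq> connected_components (inversion_graph n \<pi>)"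
    by (auto simp: connected_components_def V cuts_def intro!: quotientI)
  show "finite (connected_components (inversion_graph n \<pi>))"
    by (simp add: connected_components_def V quotient_def)
  have "\<not> i < j" if "i \<in> cuts n \<pi>" "j \<in> cuts n \<pi>" "?r `` {Suc i} = ?r `` {Suc j}" for i j
  proof
    assume "i < j"
    have "(Suc j, Suc j) \<in> ?r" using that(2) by (auto simp: connected_rel_def V cuts_def)
    then have "(Suc i, Suc j) \<in> ?r" using that(3) by blast
    then have "Suc i \<le> j \<longleftrightarrow> Suc j \<le> j"
      using connected_respects_cut[OF _ \<pi>] that(2) cuts_inv[OF \<pi>]
      unfolding connected_rel_def by blast
    then show False using \<open>i < j\<close> by simp
  qed
  then show "inj_on (\<lambda>i. ?r `` {Suc i}) (cuts n \<pi>)"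
    by (auto simp: inj_on_def) (metis linorder_neqE_nat)
qed

text \<open>The counterpart of \<open>cuts\<close> for words, which permits an induction along a sum decomposition, where the
  length varies.\<close>

definition word_cuts :: "nat list \<Rightarrow> nat set" where
  "word_cuts w = {i. i < length w \<and> perm_word (take i w)}"

lemma cuts_eq_word_cuts:
  assumes \<pi>: "\<pi> permutes {1..n}"
  shows "cuts n \<pi> = word_cuts (one_line n \<pi>)"
proof -
  have "take i (one_line n \<pi>) = map \<pi> [1..<Suc i]" if "i < n" for i
    using that by (simp add: one_line_def take_map del: upt_Suc)
  moreover have "perm_word (map \<pi> [1..<Suc i]) \<longleftrightarrow> \<pi> ` {1..i} = {1..i}" for i
    using inj_on_subset[OF permutes_inj[OF \<pi>]]
    by (simp add: perm_word_def distinct_map atLeastLessThanSuc_atLeastAtMost del: upt_Suc)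
  moreover have "length (one_line n \<pi>) = n" by (simp add: one_line_def)
  ultimately show ?thesis unfolding cuts_def word_cuts_def by force
qed

text \<open>A cut strictly inside \<open>u\<close> would split \<open>u\<close> as a direct sum, and a cut beyond \<open>u\<close> is a shifted cut of
  \<open>v\<close>. The cut at the boundary between \<open>u\<close> and \<open>v\<close> is the shifted trivial cut of \<open>v\<close>.\<close>

lemma word_cuts_direct_sum:
  assumes "perm_word u" "sum_indecomposable u"
  shows "word_cuts (u \<oplus>\<^sub>w v) \<subseteq> insert 0 ((\<lambda>i. i + length u) ` word_cuts v)"
proof
  fix i assume "i \<in> word_cuts (u \<oplus>\<^sub>w v)"
  then have i: "i < length u + length v" and pw: "perm_word (take i (u \<oplus>\<^sub>w v))"
    by (auto simp: word_cuts_def direct_sum_def)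
  consider "i = 0" | "0 < i" "i < length u" | "length u \<le> i" by linarith
  then show "i \<in> insert 0 ((\<lambda>i. i + length u) ` word_cuts v)"
  proof cases
    case 2
    then have "perm_word (take i u)" using pw unfolding direct_sum_def by simp
    then obtain z where z: "perm_word z" "u = take i u \<oplus>\<^sub>w z"
      using perm_word_suffix[of "take i u" "drop i u"] assms(1) by auto
    moreover have "z \<noteq> []"
    proof
      assume "z = []"
      then have "length u = length (take i u)" using z(2) by (simp add: direct_sum_def)
      then show False using 2 by simp
    qed
    moreover have "take i u \<noteq> []" using 2 by auto
    ultimately have False
      using assms(2) \<open>perm_word (take i u)\<close> unfolding sum_indecomposable_def by blast
    then show ?thesis ..
  next
    case 3
    define j where "j = i - length u"
    have "take i (u \<oplus>\<^sub>w v) = u @ map (\<lambda>i. i + length u) (take j v)"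
      using 3 by (simp add: direct_sum_def take_map j_def)
    then obtain z where "perm_word z" "map (\<lambda>i. i + length u) (take j v) = map (\<lambda>i. i + length u) z"
      using perm_word_suffix[OF assms(1), of "map (\<lambda>i. i + length u) (take j v)"] pw
      unfolding direct_sum_def by auto
    then have "perm_word (take j v)" by (simp add: map_add_eq_iff)
    then have "j \<in> word_cuts v" using i 3 by (simp add: word_cuts_def j_def)
    then show ?thesis using 3 by (auto simp: j_def image_iff intro!: bexI[of _ j])
  qed simp
qed

lemma finite_word_cuts: "finite (word_cuts w)"
  by (rule finite_subset[of _ "{..<length w}"]) (auto simp: word_cuts_def)

lemma card_word_cuts_le_decomposition:
  assumes "is_sum_decomposition \<alpha>s w"
  shows "card (word_cuts w) \<le> length \<alpha>s"
  using assms
proof (induction \<alpha>s arbitrary: w)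
  case Nil
  then show ?case by (simp add: is_sum_decomposition_def word_cuts_def)
next
  case (Cons u \<alpha>s)
  define v where "v = foldr (\<oplus>\<^sub>w) \<alpha>s []"
  have w: "w = u \<oplus>\<^sub>w v" and u: "perm_word u" "sum_indecomposable u"
    and v: "is_sum_decomposition \<alpha>s v"
    using Cons.prems by (auto simp: is_sum_decomposition_def v_def)
  have "card (word_cuts w) \<le> card (insert 0 ((\<lambda>i. i + length u) ` word_cuts v))"
    unfolding w using finite_word_cuts by (intro card_mono word_cuts_direct_sum u) simp
  also have "\<dots> \<le> Suc (card ((\<lambda>i. i + length u) ` word_cuts v))"
    by (rule card_insert_le_m1) simp_all
  also have "\<dots> \<le> Suc (card (word_cuts v))"
    using card_image_le[OF finite_word_cuts] by simp
  also have "\<dots> \<le> length (u # \<alpha>s)" using Cons.IH[OF v] by simp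
  finally show ?case .
qed

lemma card_cuts_le_sum_component_count:
  assumes \<pi>: "\<pi> permutes {1..n}"
  shows "card (cuts n \<pi>) \<le> sum_component_count n \<pi>"
proof -
  have "is_sum_decomposition (sum_components (one_line n \<pi>)) (one_line n \<pi>)"
    unfolding sum_components_def
    by (rule theI'[OF ex1_sum_decomposition[OF perm_word_one_line[OF \<pi>]]])
  then show ?thesis
    unfolding sum_component_count_def cuts_eq_word_cuts[OF \<pi>]
    by (rule card_word_cuts_le_decomposition)
qed

section \<open>The inequality\<close>

theorem theorem1p3:
  fixes n :: nat and \<pi> :: "nat \<Rightarrow> nat"
  assumes "n \<ge> 1"
    and "\<pi> permutes {1..n}"
  shows "int (cycle_count n \<pi>) - int (sum_component_count n \<pi>)
           \<le> cyclomatic_number (inversion_graph n \<pi>)"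
proof -
  note \<pi> = assms(2)
  have "cycle_count n \<pi> + n \<le> card (inversions n (inv \<pi>)) + 2 * card (cuts n \<pi>)"
    using cycles_le_inversions_cuts[OF permutes_inv[OF \<pi>]]
    by (simp add: cycle_count_inv[OF \<pi>] cuts_inv[OF \<pi>])
  moreover have "card (verts (inversion_graph n \<pi>)) = n" by (simp add: inversion_graph_def)
  ultimately show ?thesis
    using card_cuts_le_connected_components[OF \<pi>] card_cuts_le_sum_component_count[OF \<pi>]
    by (simp add: cyclomatic_number_def card_edges_inversion_graph)
qed

end
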